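(* Let $k\ge 3$ be the number of outcomes. There is no scoring rule $\mathbf{S}:\Delta\to\mathbb{R}^k$ on the simplex $\Delta$ of probability distributions over the $k$ outcomes that satisfies the technical conditions (continuity, differentiability and quasiconcavity) and also satisfies the budget-constrained truthfulness property.
   Context: Fix a finite set $\Omega$ of $k$ outcomes and let $\Delta$ be the set of all probability vectors $\mathbf{p}=(p_\omega)_{\omega\in\Omega}$ (nonnegative entries summing to $1$). A scoring rule is a map $\mathbf{S}=(S_\omega)_{\omega\in\Omega}:\Delta\to\mathbb{R}^k$; an agent with belief $\mathbf{p}$ reporting $\mathbf{q}$ has expected score $\mathbf{p}\cdot\mathbf{S}(\mathbf{q})$. Technical conditions: (i) $\mathbf{S}$ is continuous and differentiable on the (relative) interior of $\Delta$; (ii) quasiconcavity: for every outcome $\omega$ and all $\mathbf{p},\mathbf{q}\in\Delta$, $S_\omega(0.5\mathbf{p}+0.5\mathbf{q})\ge\min(S_\omega(\mathbf{p}),S_\omega(\mathbf{q}))$, with equality only if $S_\omega(\mathbf{p})=S_\omega(\mathbf{q})$. Natural budget: for $\overline{\mathbf{q}},\mathbf{q}\in\Delta$, $\mathrm{nb}(\overline{\mathbf{q}},\mathbf{q})=\max_{\omega\in\Omega}\,[S_\omega(\overline{\mathbf{q}})-S_\omega(\mathbf{q})]$. Budget-constrained optimal report: for belief $\mathbf{p}$, reference point $\overline{\mathbf{q}}$ and budget $b$, $\mathbf{q}^*(\mathbf{p},\overline{\mathbf{q}},b)$ denotes the unique maximizer of $\mathbf{p}\cdot\mathbf{S}(\mathbf{q})$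 among all $\mathbf{q}\in\Delta$ with $\mathrm{nb}(\overline{\mathbf{q}},\mathbf{q})\le b$. Budget-constrained truthfulness property: for all $\mathbf{p},\overline{\mathbf{q}}\in\Delta$ and all $b>0$, the unique maximizer $\mathbf{q}^*(\mathbf{p},\overline{\mathbf{q}},b)$ exists and equals $\alpha\mathbf{p}+(1-\alpha)\overline{\mathbf{q}}$, where $\alpha=\max\{\alpha\in[0,1] : \mathrm{nb}(\overline{\mathbf{q}},\alpha\mathbf{p}+(1-\alpha)\overline{\mathbf{q}})\le b\}$. (In particular $\mathbf{S}$ is strictly proper: for each $\mathbf{p}$, the unique maximizer of $\mathbf{p}\cdot\mathbf{S}(\mathbf{q})$ is $\mathbf{q}=\mathbf{p}$.) *)

theory Defs
  imports "HOL-Analysis.Analysis"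
begin

text \<open>
  The outcomes are the elements of a finite type \<open>'n\<close>. A scoring rule is a total function
  on \<open>real^'n\<close>, but every notion below looks only at its values on \<open>prob_simplex\<close>.
\<close>

definition prob_simplex :: "(real^'n::finite) set" where
  "prob_simplex = {p. (\<forall>\<omega>. 0 \<le> p $ \<omega>) \<and> (\<Sum>\<omega>\<in>UNIV. p $ \<omega>) = 1}"

type_synonym 'n scoring_rule = "real^'n \<Rightarrow> real^'n"

definition expected_score :: "'n::finite scoring_rule \<Rightarrow> real^'n \<Rightarrow> real^'n \<Rightarrow> real" where
  "expected_score S p q = p \<bullet> S q"

text \<open>
  The simplex has empty interior in \<open>real^'n\<close>, so differentiability is taken within
  its relative interior. Nothing is required of \<open>S\<close> at the relative boundary.
\<close>

definition differentiable_inside :: "'n::finite scoring_rule \<Rightarrow> bool" where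
  "differentiable_inside S \<longleftrightarrow>
     continuous_on (rel_interior prob_simplex) S \<and>
     S differentiable_on (rel_interior prob_simplex)"

definition quasiconcave :: "'n::finite scoring_rule \<Rightarrow> bool" where
  "quasiconcave S \<longleftrightarrow>
     (\<forall>\<omega>. \<forall>p\<in>prob_simplex. \<forall>q\<in>prob_simplex.
        S ((1/2) *\<^sub>R p + (1/2) *\<^sub>R q) $ \<omega> \<ge> min (S p $ \<omega>) (S q $ \<omega>) \<and>
        (S ((1/2) *\<^sub>R p + (1/2) *\<^sub>R q) $ \<omega> = min (S p $ \<omega>) (S q $ \<omega>)
           \<longrightarrow> S p $ \<omega> = S q $ \<omega>))"

definition technical_conditions :: "'n::finite scoring_rule \<Rightarrow> bool" where
  "technical_conditions S \<longleftrightarrow> differentiable_inside S \<and> quasiconcave S"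

definition natural_budget :: "'n::finite scoring_rule \<Rightarrow> real^'n \<Rightarrow> real^'n \<Rightarrow> real" where
  "natural_budget S qbar q = (MAX \<omega>. S qbar $ \<omega> - S q $ \<omega>)"

definition is_optimal_report ::
  "'n::finite scoring_rule \<Rightarrow> real^'n \<Rightarrow> real^'n \<Rightarrow> real \<Rightarrow> real^'n \<Rightarrow> bool" where
  "is_optimal_report S p qbar b =
     is_arg_max (expected_score S p) (\<lambda>q. q \<in> prob_simplex \<and> natural_budget S qbar q \<le> b)"

text \<open>Meaningful only when the maximizer exists and is unique.\<close>

definition optimal_report ::
  "'n::finite scoring_rule \<Rightarrow> real^'n \<Rightarrow> real^'n \<Rightarrow> real \<Rightarrow> real^'n" where
  "optimal_report S p qbar b = (THE q. is_optimal_report S p qbar b q)"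

definition affordable_weights ::
  "'n::finite scoring_rule \<Rightarrow> real^'n \<Rightarrow> real^'n \<Rightarrow> real \<Rightarrow> real set" where
  "affordable_weights S p qbar b =
     {\<alpha> \<in> {0..1}. natural_budget S qbar (\<alpha> *\<^sub>R p + (1 - \<alpha>) *\<^sub>R qbar) \<le> b}"

text \<open>
  \<open>\<alpha>\<close> is a maximum, not merely a supremum: that it is attained is part of the property.
\<close>

definition budget_truthful :: "'n::finite scoring_rule \<Rightarrow> bool" where
  "budget_truthful S \<longleftrightarrow>
     (\<forall>p\<in>prob_simplex. \<forall>qbar\<in>prob_simplex. \<forall>b>0.
        (\<exists>!q. is_optimal_report S p qbar b q) \<and>
        (\<exists>\<alpha>. \<alpha> \<in> affordable_weights S p qbar b \<and>
             (\<forall>\<beta>\<in>affordable_weights S p qbar b. \<beta> \<le> \<alpha>) \<and>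
             optimal_report S p qbar b = \<alpha> *\<^sub>R p + (1 - \<alpha>) *\<^sub>R qbar))"

end

theory Submission
  imports Defs
begin

text \<open>
  Strict propriety makes \<open>S q\<close> the unique point of the range of \<open>S\<close> supported by \<open>q\<close>, so moving from
  \<open>S q\<close> in any direction \<open>w\<close> with \<open>w \<bullet> q < 0\<close> leads to a point that some \<open>S r\<close> dominates in every
  coordinate. Hence at an interior constrained optimum \<open>q\<close> for belief \<open>p\<close>, the budget constraint of
  \<open>j\<close> binds as soon as \<open>p\<^sub>j / q\<^sub>j\<close> is not the largest such ratio. Quasiconcavity makes the natural
  budget strictly increasing along segments, so every interior \<open>q\<close> is such an optimum relative to
  every interior \<open>qbar\<close>, and \<open>S\<^sub>j qbar - S\<^sub>j q\<close> takes the same value for all \<open>j\<close> except the maximizer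
  of \<open>q\<^sub>j / qbar\<^sub>j\<close>. Apply this to two points whose ratio has a unique maximizer \<open>a\<close> and a
  unique minimizer \<open>c\<close>, in both orders: at a third outcome both conclusions hold, so the two natural
  budgets are opposite numbers, whereas propriety makes both of them positive.
\<close>

section \<open>Strict propriety and the geometry of the simplex\<close>

definition strictly_proper :: "'n::finite scoring_rule \<Rightarrow> bool" where
  "strictly_proper S \<longleftrightarrow>
     (\<forall>p\<in>prob_simplex. \<forall>q\<in>prob_simplex. q \<noteq> p \<longrightarrow> p \<bullet> S q < p \<bullet> S p)"

text \<open>This is the relative interior of \<open>prob_simplex\<close> in coordinates, where
  continuity of \<open>S\<close> is available.\<close>

definition pos_simplex :: "(real^'n::finite) set" where
  "pos_simplex = {p. (\<forall>\<omega>. 0 < p $ \<omega>) \<and> (\<Sum>\<omega>\<in>UNIV. p $ \<omega>) = 1}"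

lemma pos_simplex_subset: "pos_simplex \<subseteq> prob_simplex"
  by (auto simp: pos_simplex_def prob_simplex_def less_imp_le)

lemma open_positive: "open {r::real^'n::finite. \<forall>\<omega>. 0 < r $ \<omega>}"
proof -
  have "{r::real^'n. \<forall>\<omega>. 0 < r $ \<omega>} = (\<Inter>\<omega>. {r. 0 < r $ \<omega>})" by auto
  moreover have "open (\<Inter>\<omega>. {r::real^'n. 0 < r $ \<omega>})"
    by (intro open_INT ballI finite open_halfspace_component_gt_cart)
  ultimately show ?thesis by simp
qed

lemma closed_prob_simplex: "closed (prob_simplex :: (real^'n::finite) set)"
proof -
  have "closed ((\<Inter>\<omega>. {r::real^'n. 0 \<le> r $ \<omega>}) \<inter> {r. (\<Sum>\<omega>\<in>UNIV. r $ \<omega>) = 1})"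
    by (intro closed_Int closed_INT ballI closed_halfspace_component_ge_cart closed_Collect_eq
        continuous_intros)
  also have "(\<Inter>\<omega>. {r::real^'n. 0 \<le> r $ \<omega>}) \<inter> {r. (\<Sum>\<omega>\<in>UNIV. r $ \<omega>) = 1} = prob_simplex"
    by (auto simp: prob_simplex_def)
  finally show ?thesis .
qed

lemma segment_in_prob_simplex:
  fixes p q :: "real^'n::finite"
  assumes "p \<in> prob_simplex" "q \<in> prob_simplex" "0 \<le> t" "t \<le> 1"
  shows "t *\<^sub>R p + (1 - t) *\<^sub>R q \<in> prob_simplex"
  using assms by (auto simp: prob_simplex_def sum.distrib simp flip: sum_distrib_left)

lemma segment_in_pos_simplex:
  fixes p q :: "real^'n::finite"
  assumes "p \<in> pos_simplex" "q \<in> pos_simplex" "0 \<le> t" "t \<le> 1"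
  shows "t *\<^sub>R p + (1 - t) *\<^sub>R q \<in> pos_simplex"
proof -
  have "0 < t * p $ \<omega> + (1 - t) * q $ \<omega>" for \<omega>
    using assms
    by (cases "t = 0") (auto simp: pos_simplex_def less_imp_le intro!: add_pos_nonneg mult_nonneg_nonneg)
  then show ?thesis
    using assms by (auto simp: pos_simplex_def sum.distrib simp flip: sum_distrib_left)
qed

lemma pos_simplex_subset_rel_interior: "pos_simplex \<subseteq> rel_interior (prob_simplex :: (real^'n::finite) set)"
proof
  fix p :: "real^'n" assume p: "p \<in> pos_simplex"
  have "affine {r::real^'n. (\<Sum>\<omega>\<in>UNIV. r $ \<omega>) = 1}"
    by (auto simp: affine_def sum.distrib simp flip: sum_distrib_left)
  then have aff: "affine hull prob_simplex \<subseteq> {r::real^'n. (\<Sum>\<omega>\<in>UNIV. r $ \<omega>) = 1}"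
    by (intro hull_minimal) (auto simp: prob_simplex_def)
  have "p \<in> {r. \<forall>\<omega>. 0 < r $ \<omega>}" using p by (auto simp: pos_simplex_def)
  with open_positive obtain e where "e > 0" "ball p e \<subseteq> {r. \<forall>\<omega>. 0 < r $ \<omega>}"
    unfolding open_contains_ball by blast
  then have "e > 0" "ball p e \<inter> affine hull prob_simplex \<subseteq> prob_simplex"
    using aff by (auto simp: prob_simplex_def subset_iff less_imp_le)
  then show "p \<in> rel_interior prob_simplex"
    using p pos_simplex_subset by (auto simp: mem_rel_interior_ball)
qed

section \<open>Natural budgets and constrained optima\<close>

lemma natural_budget_le_iff:
  "natural_budget S qbar q \<le> b \<longleftrightarrow> (\<forall>\<omega>. S qbar $ \<omega> - S q $ \<omega> \<le> b)"
  by (auto simp: natural_budget_def)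

lemma natural_budget_less_iff:
  "natural_budget S qbar q < b \<longleftrightarrow> (\<forall>\<omega>. S qbar $ \<omega> - S q $ \<omega> < b)"
  by (auto simp: natural_budget_def)

lemma natural_budget_ge: "S qbar $ \<omega> - S q $ \<omega> \<le> natural_budget S qbar q"
  using natural_budget_le_iff by blast

lemma positive_inner_has_positive_coordinate:
  fixes p x :: "real^'n::finite"
  assumes "p \<in> prob_simplex" "0 < p \<bullet> x"
  obtains \<omega> where "0 < x $ \<omega>"
proof -
  have "\<not> (\<forall>\<omega>. x $ \<omega> \<le> 0)"
  proof
    assume "\<forall>\<omega>. x $ \<omega> \<le> 0"
    then have "p \<bullet> x \<le> 0"
      using assms(1) by (auto simp: inner_vec_def prob_simplex_def intro!: sum_nonpos mult_nonneg_nonpos)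
    with assms(2) show False by simp
  qed
  then show ?thesis using that by (auto simp: not_le)
qed

text \<open>An agent with belief \<open>q\<close> expects a loss when the report moves from
  \<open>q\<close> to \<open>p\<close>, so the score drops in some outcome.\<close>

lemma natural_budget_pos:
  assumes "strictly_proper S" "p \<in> prob_simplex" "q \<in> prob_simplex" "p \<noteq> q"
  shows "0 < natural_budget S q p"
proof -
  have "0 < q \<bullet> (S q - S p)"
    using assms by (auto simp: strictly_proper_def inner_diff_right)
  then obtain \<omega> where "0 < (S q - S p) $ \<omega>"
    using positive_inner_has_positive_coordinate assms(3) by blast
  then show ?thesis using natural_budget_ge[of S q \<omega> p] by simp
qed

lemma is_optimal_report_iff:
  "is_optimal_report S p qbar b q \<longleftrightarrow>
     q \<in> prob_simplex \<and> natural_budget S qbar q \<le> b \<and>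
     (\<forall>r\<in>prob_simplex. natural_budget S qbar r \<le> b \<longrightarrow> p \<bullet> S r \<le> p \<bullet> S q)"
  by (auto simp: is_optimal_report_def is_arg_max_def expected_score_def not_less)

text \<open>A set of weights has at most one maximum, so the weight supplied by
  \<open>budget_truthful\<close> must be \<open>t\<close>. This replaces the existential and the
  definite description by a concrete report.\<close>

lemma optimal_report_affordable_max:
  assumes "budget_truthful S" "p \<in> prob_simplex" "qbar \<in> prob_simplex" "0 < b"
    and t: "t \<in> affordable_weights S p qbar b"
    and max: "\<And>s. s \<in> affordable_weights S p qbar b \<Longrightarrow> s \<le> t"
  shows "is_optimal_report S p qbar b (t *\<^sub>R p + (1 - t) *\<^sub>R qbar)"
    and "\<And>q. is_optimal_report S p qbar b q \<Longrightarrow> q = t *\<^sub>R p + (1 - t) *\<^sub>R qbar"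
proof -
  obtain \<alpha> where ex: "\<exists>!q. is_optimal_report S p qbar b q"
    and \<alpha>: "\<alpha> \<in> affordable_weights S p qbar b" "\<forall>\<beta>\<in>affordable_weights S p qbar b. \<beta> \<le> \<alpha>"
    and eq: "optimal_report S p qbar b = \<alpha> *\<^sub>R p + (1 - \<alpha>) *\<^sub>R qbar"
    using assms unfolding budget_truthful_def by blast
  have "\<alpha> = t" using \<alpha> t max by (meson antisym)
  then show opt: "is_optimal_report S p qbar b (t *\<^sub>R p + (1 - t) *\<^sub>R qbar)"
    using theI'[OF ex] eq by (simp add: optimal_report_def)
  then show "\<And>q. is_optimal_report S p qbar b q \<Longrightarrow> q = t *\<^sub>R p + (1 - t) *\<^sub>R qbar"
    using ex by blast
qed

text \<open>With a budget that makes \<open>p\<close> affordable from the reference point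
  \<open>q\<close>, the largest weight is 1, so \<open>p\<close> is the unique optimum. The report
  \<open>q\<close> is affordable too, hence scores strictly less.\<close>

lemma budget_truthful_imp_strictly_proper:
  fixes S :: "'n::finite scoring_rule"
  assumes S: "budget_truthful S"
  shows "strictly_proper S"
  unfolding strictly_proper_def
proof (intro ballI impI)
  fix p q :: "real^'n" assume p: "p \<in> prob_simplex" and q: "q \<in> prob_simplex" and "q \<noteq> p"
  \<comment> \<open>The budget covers the cost of \<open>p\<close>; the 1 makes it positive, as
    \<open>budget_truthful\<close> requires.\<close>
  define b where "b = max 1 (natural_budget S q p)"
  have b: "0 < b" "natural_budget S q p \<le> b" by (auto simp: b_def)
  have 1: "1 \<in> affordable_weights S p q b" "\<And>s. s \<in> affordable_weights S p q b \<Longrightarrow> s \<le> 1"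
    using b by (auto simp: affordable_weights_def)
  note opt = optimal_report_affordable_max[OF S p q b(1) 1, simplified]
  have "natural_budget S q q \<le> b" using b by (simp add: natural_budget_le_iff)
  then have "p \<bullet> S q \<le> p \<bullet> S p" using opt(1) q by (auto simp: is_optimal_report_iff)
  moreover have "p \<bullet> S q \<noteq> p \<bullet> S p"
  proof
    assume "p \<bullet> S q = p \<bullet> S p"
    then have "is_optimal_report S p q b q"
      using opt(1) q \<open>natural_budget S q q \<le> b\<close> by (auto simp: is_optimal_report_iff)
    with opt(2) \<open>q \<noteq> p\<close> show False by blast
  qed
  ultimately show "p \<bullet> S q < p \<bullet> S p" by simp
qed

section \<open>Domination and binding constraints\<close>

text \<open>
  The report \<open>r\<close> minimizes \<open>r \<bullet> S r - r \<bullet> x\<close> near \<open>q\<close>, where \<open>x = S q + \<epsilon> w\<close>. Since \<open>S\<close> is a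
  subgradient of \<open>r \<bullet> S r\<close>, the first-order condition at \<open>r\<close> bounds every coordinate of \<open>S r - x\<close>
  from below by the minimum, which is positive.
\<close>

lemma dominating_report:
  fixes S :: "'n::finite scoring_rule"
  assumes proper: "strictly_proper S" and cont: "continuous_on pos_simplex S"
    and q: "q \<in> pos_simplex" and wq: "w \<bullet> q < 0" and "0 < e"
  obtains r \<epsilon> where "r \<in> prob_simplex" "0 < \<epsilon>" "\<epsilon> < e" "\<And>i. S q $ i + \<epsilon> * w $ i < S r $ i"
proof -
  \<comment> \<open>Positive coordinates keep the reports near \<open>q\<close> inside
    \<open>pos_simplex\<close>, and \<open>w \<bullet> r < 0\<close> will make
    \<open>r \<bullet> (S r - x)\<close> positive throughout \<open>K\<close>.\<close>
  define U where "U = {r::real^'n. w \<bullet> r < 0} \<inter> {r. \<forall>\<omega>. 0 < r $ \<omega>}"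
  have "open U" unfolding U_def by (intro open_Int open_positive open_halfspace_lt)
  moreover have "q \<in> U" using q wq by (auto simp: U_def pos_simplex_def)
  ultimately obtain \<rho> where \<rho>: "0 < \<rho>" "cball q \<rho> \<subseteq> U" by (meson open_contains_cball)
  define K where "K = cball q \<rho> \<inter> prob_simplex"
  have K: "compact K" unfolding K_def by (intro compact_Int_closed closed_prob_simplex) auto
  have Kpos: "K \<subseteq> pos_simplex"
    using \<rho> by (auto simp: K_def U_def pos_simplex_def prob_simplex_def)
  have Kw: "w \<bullet> r < 0" if "r \<in> K" for r using that \<rho> by (auto simp: K_def U_def)
  have qK: "q \<in> K" using q pos_simplex_subset \<rho> by (auto simp: K_def)
  have contK: "continuous_on K S" using cont Kpos continuous_on_subset by blast
  have gap: "0 < r \<bullet> (S r - S q)" if "r \<in> K" "r \<noteq> q" for r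
    using proper that qK by (auto simp: strictly_proper_def K_def inner_diff_right)
  obtain \<delta> where \<delta>: "0 < \<delta>" "\<And>r. r \<in> K \<inter> sphere q \<rho> \<Longrightarrow> \<delta> \<le> r \<bullet> (S r - S q)"
  proof (cases "K \<inter> sphere q \<rho> = {}")
    \<comment> \<open>This happens when there is a single outcome; any positive \<delta> then
      serves.\<close>
    case True
    then show ?thesis using that[of 1] by auto
  next
    case False
    have "compact (K \<inter> sphere q \<rho>)" using K by (intro compact_Int_closed) auto
    moreover have "continuous_on (K \<inter> sphere q \<rho>) (\<lambda>r. r \<bullet> (S r - S q))"
      by (intro continuous_intros continuous_on_subset[OF contK]) auto
    ultimately obtain s where s: "s \<in> K \<inter> sphere q \<rho>"
        "\<forall>r\<in>K \<inter> sphere q \<rho>. s \<bullet> (S s - S q) \<le> r \<bullet> (S r - S q)"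
      using continuous_attains_inf False by blast
    then have "s \<noteq> q" using \<rho>(1) by auto
    then show ?thesis using that[of "s \<bullet> (S s - S q)"] gap s by blast
  qed
  \<comment> \<open>The second bound makes the objective at \<open>q\<close> at most \<delta> / 2,
    while it exceeds \<delta> on the sphere, so its minimizer lies in the open ball.\<close>
  define \<epsilon> where "\<epsilon> = min (e / 2) (\<delta> / (2 * (- (w \<bullet> q))))"
  have \<epsilon>: "0 < \<epsilon>" "\<epsilon> < e" using \<open>0 < e\<close> \<delta>(1) wq by (auto simp: \<epsilon>_def divide_pos_neg)
  have "\<epsilon> * (- (w \<bullet> q)) \<le> \<delta> / (2 * (- (w \<bullet> q))) * (- (w \<bullet> q))"
    using wq by (intro mult_right_mono) (auto simp: \<epsilon>_def)
  also have "\<dots> = \<delta> / 2" using wq by (simp add: field_simps)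
  finally have \<epsilon>\<delta>: "\<epsilon> * (- (w \<bullet> q)) < \<delta>" using \<delta>(1) by simp
  define x where "x = S q + \<epsilon> *\<^sub>R w"
  have h: "r \<bullet> (S r - x) = r \<bullet> (S r - S q) + \<epsilon> * (- (w \<bullet> r))" for r
    by (simp add: x_def algebra_simps inner_diff_right inner_add_right inner_commute)
  have "continuous_on K (\<lambda>r. r \<bullet> (S r - x))" by (intro continuous_intros contK)
  then obtain r where r: "r \<in> K" and rmin: "\<And>s. s \<in> K \<Longrightarrow> r \<bullet> (S r - x) \<le> s \<bullet> (S s - x)"
    using continuous_attains_inf[OF K, of "\<lambda>r. r \<bullet> (S r - x)"] qK by blast
  have rS: "r \<in> prob_simplex" using r by (simp add: K_def)
  have "dist q r < \<rho>"
  proof (rule ccontr)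
    assume "\<not> dist q r < \<rho>"
    then have "r \<in> K \<inter> sphere q \<rho>" using r by (auto simp: K_def)
    moreover have "0 < \<epsilon> * (- (w \<bullet> r))" using Kw[OF r] \<epsilon> by (simp add: mult_pos_neg)
    ultimately have "\<delta> < r \<bullet> (S r - x)" using \<delta>(2) by (fastforce simp: h)
    then show False using rmin[OF qK] \<epsilon>\<delta> by (simp add: h)
  qed
  have pos: "0 < r \<bullet> (S r - x)"
  proof -
    have "0 \<le> r \<bullet> (S r - S q)" using gap[OF r] by (cases "r = q") auto
    moreover have "0 < \<epsilon> * (- (w \<bullet> r))" using Kw[OF r] \<epsilon> by (simp add: mult_pos_neg)
    ultimately show ?thesis by (simp add: h)
  qed
  have "S q $ i + \<epsilon> * w $ i < S r $ i" for i
  proof -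
    \<comment> \<open>Since \<open>v\<close> points from \<open>r\<close> to the vertex
      \<open>i\<close>, \<open>v \<bullet> (S r - x)\<close> is the coordinate \<open>i\<close> of
      \<open>S r - x\<close> minus the minimum value.\<close>
    define v where "v = axis i 1 - r"
    define c where "c = (\<lambda>t. r + t *\<^sub>R v)"
    have axis: "axis i 1 \<in> (prob_simplex :: (real^'n) set)"
      by (auto simp: prob_simplex_def axis_def)
    have c_simplex: "c t \<in> prob_simplex" if "0 \<le> t" "t \<le> 1" for t
      using segment_in_prob_simplex[OF axis rS that] by (simp add: c_def v_def algebra_simps)
    have c_lim: "(c \<longlongrightarrow> r) (at_right 0)"
      unfolding c_def by (auto intro!: tendsto_eq_intros)
    have "\<forall>\<^sub>F t in at_right 0. dist q (c t) < \<rho>"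
      by (rule order_tendstoD(2)[OF tendsto_dist[OF tendsto_const c_lim] \<open>dist q r < \<rho>\<close>])
    moreover have "\<forall>\<^sub>F t in at_right 0. t < (1::real)"
      by (rule order_tendstoD(2)[OF tendsto_ident_at]) simp
    moreover have "\<forall>\<^sub>F t in at_right 0. (0::real) < t" by (rule eventually_at_right_less)
    ultimately have ev: "\<forall>\<^sub>F t in at_right 0. 0 < t \<and> c t \<in> K"
      by eventually_elim (auto simp: K_def c_simplex)
    have "\<forall>\<^sub>F t in at_right 0. 0 \<le> v \<bullet> (S (c t) - x)"
      using ev
    proof eventually_elim
      case (elim t)
      \<comment> \<open>The first inequality is propriety at belief \<open>r\<close>, the next one
        minimality of \<open>r\<close>. The two outer terms differ by \<open>t\<close> times the
        inner product with \<open>v\<close>.\<close>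
      have "r \<bullet> (S (c t) - x) \<le> r \<bullet> (S r - x)"
        using proper rS elim by (cases "c t = r")
          (auto simp: strictly_proper_def K_def inner_diff_right less_imp_le)
      also have "\<dots> \<le> c t \<bullet> (S (c t) - x)" using elim by (intro rmin) auto
      finally have "0 \<le> t * (v \<bullet> (S (c t) - x))" by (simp add: c_def inner_add_left)
      then show ?case using elim by (simp add: zero_le_mult_iff)
    qed
    moreover have "((\<lambda>t. S (c t)) \<longlongrightarrow> S r) (at_right 0)"
      by (rule continuous_on_tendsto_compose[OF contK c_lim r])
        (use ev in \<open>auto elim: eventually_mono\<close>)
    then have "((\<lambda>t. v \<bullet> (S (c t) - x)) \<longlongrightarrow> v \<bullet> (S r - x)) (at_right 0)"
      by (intro tendsto_intros)
    ultimately have "0 \<le> v \<bullet> (S r - x)"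
      by (intro tendsto_lowerbound) auto
    then have "r \<bullet> (S r - x) \<le> (S r - x) $ i"
      by (simp add: v_def inner_diff_left inner_axis')
    then show ?thesis using pos by (simp add: x_def)
  qed
  then show ?thesis using that rS \<epsilon> by blast
qed

text \<open>Suppose \<open>j\<close> has slack. The direction \<open>w\<close> is orthogonal to
  \<open>p\<close>, negative only at \<open>j\<close>, and satisfies
  \<open>w \<bullet> q < 0\<close>, so some report dominates a small step from \<open>S q\<close>
  along \<open>w\<close>. That report stays within budget, and positivity of \<open>p\<close> makes
  its expected score exceed that of \<open>q\<close>.\<close>

lemma optimal_report_binding:
  fixes S :: "'n::finite scoring_rule"
  assumes proper: "strictly_proper S" and cont: "continuous_on pos_simplex S"
    and p: "p \<in> pos_simplex" and q: "q \<in> pos_simplex" and opt: "is_optimal_report S p qbar b q"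
    and less: "p $ j * q $ i < p $ i * q $ j"
  shows "S qbar $ j - S q $ j = b"
proof (rule ccontr)
  have feas: "S qbar $ \<omega> - S q $ \<omega> \<le> b" for \<omega>
    using opt by (auto simp: is_optimal_report_iff natural_budget_le_iff)
  assume "S qbar $ j - S q $ j \<noteq> b"
  then have slack: "0 < b - (S qbar $ j - S q $ j)" using feas[of j] by simp
  have pos: "0 < p $ \<omega>" for \<omega> using p by (simp add: pos_simplex_def)
  have "i \<noteq> j" using less by auto
  define w :: "real^'n" where "w = p $ j *\<^sub>R axis i 1 - p $ i *\<^sub>R axis j 1"
  have w: "w \<bullet> r = p $ j * r $ i - p $ i * r $ j" for r
    by (simp add: w_def inner_diff_left inner_axis')
  have wj: "w $ j = - (p $ i)" using \<open>i \<noteq> j\<close> by (simp add: w_def axis_def)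
  have w_nonneg: "0 \<le> w $ \<omega>" if "\<omega> \<noteq> j" for \<omega>
    using that pos[of j] by (simp add: w_def axis_def)
  have "w \<bullet> q < 0" using less by (simp add: w)
  \<comment> \<open>Below this bound, the loss \<open>\<epsilon> * p $ i\<close> at outcome
    \<open>j\<close> fits into its slack.\<close>
  moreover have "0 < (b - (S qbar $ j - S q $ j)) / p $ i" using slack pos by simp
  ultimately obtain r \<epsilon> where r: "r \<in> prob_simplex" and \<epsilon>: "0 < \<epsilon>"
      "\<epsilon> < (b - (S qbar $ j - S q $ j)) / p $ i"
    and dom: "\<And>\<omega>. S q $ \<omega> + \<epsilon> * w $ \<omega> < S r $ \<omega>"
    using dominating_report[OF proper cont q] by metis
  have "S qbar $ \<omega> - S r $ \<omega> \<le> b" for \<omega>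
  proof (cases "\<omega> = j")
    case True
    have "\<epsilon> * p $ i < b - (S qbar $ j - S q $ j)" using \<epsilon> pos[of i] by (simp add: pos_less_divide_eq)
    then show ?thesis using dom[of j] True by (simp add: wj)
  next
    case False
    have "0 \<le> \<epsilon> * w $ \<omega>" using \<epsilon> w_nonneg[OF False] by simp
    then show ?thesis using dom[of \<omega>] feas[of \<omega>] by simp
  qed
  then have "p \<bullet> S r \<le> p \<bullet> S q"
    using opt r by (auto simp: is_optimal_report_iff natural_budget_le_iff)
  moreover have "p \<bullet> (S q + \<epsilon> *\<^sub>R w) < p \<bullet> S r"
    unfolding inner_vec_def using pos dom by (intro sum_strict_mono) auto
  moreover have "p \<bullet> w = 0" by (simp add: w inner_commute[of p])
  ultimately show False by (simp add: inner_add_right)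
qed

section \<open>Monotonicity of the natural budget along segments\<close>

text \<open>Take the leftmost minimizer \<open>m\<close>. If it were interior, the equality clause
  at two points symmetric about \<open>m\<close> would make both of them minimizers, one further
  left. So \<open>m\<close> is 0, giving the first alternative, or 1, where being leftmost makes the
  inequality strict.\<close>

lemma midpoint_quasiconcave_segment:
  fixes g :: "real \<Rightarrow> real"
  assumes cont: "continuous_on {0..1} g"
    and mid: "\<And>x y. x \<in> {0..1} \<Longrightarrow> y \<in> {0..1} \<Longrightarrow> min (g x) (g y) \<le> g ((x + y) / 2)"
    and eq: "\<And>x y. x \<in> {0..1} \<Longrightarrow> y \<in> {0..1} \<Longrightarrow> g ((x + y) / 2) = min (g x) (g y) \<Longrightarrow> g x = g y"
    and t: "0 \<le> t" "t < 1"
  shows "g 0 \<le> g t \<or> g 1 < g t"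
proof -
  obtain s where s: "s \<in> {0..1}" "\<forall>x\<in>{0..1}. g s \<le> g x"
    using continuous_attains_inf[OF compact_Icc _ cont] by auto
  have "closed ({0..1} \<inter> g -` {..g s})"
    by (intro continuous_closed_preimage cont closed_real_atLeastAtMost closed_atMost)
  then have "compact ({0..1} \<inter> g -` {..g s})"
    by (auto simp: compact_eq_bounded_closed intro: bounded_Int)
  then obtain m where m: "m \<in> {0..1}" "g m \<le> g s" and least: "\<And>x. x \<in> {0..1} \<Longrightarrow> g x \<le> g s \<Longrightarrow> m \<le> x"
    using compact_attains_inf[of "{0..1} \<inter> g -` {..g s}"] s(1) by (force simp: Bex_def)
  have min_m: "g m \<le> g x" if "x \<in> {0..1}" for x using that m s by force
  consider "m = 0" | "m = 1" | "0 < m" "m < 1" using m by force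
  then show ?thesis
  proof cases
    case 1
    then show ?thesis using min_m t by auto
  next
    case 2
    then have "\<not> g t \<le> g s" using least[of t] t by auto
    then show ?thesis using 2 m by auto
  next
    case 3
    define h where "h = min m (1 - m)"
    have h: "0 < h" "m - h \<in> {0..1}" "m + h \<in> {0..1}" using 3 by (auto simp: h_def)
    have "min (g (m - h)) (g (m + h)) \<le> g m" using mid[OF h(2,3)] by simp
    moreover have "g m \<le> min (g (m - h)) (g (m + h))" using min_m h by simp
    ultimately have *: "g m = min (g (m - h)) (g (m + h))" by simp
    then have "g (m - h) = g (m + h)" using eq[OF h(2,3)] by simp
    then have "g (m - h) \<le> g s" using * m by simp
    then show ?thesis using least[OF h(2)] h(1) by simp
  qed
qed

text \<open>In each coordinate, either the score is at least the one at \<open>q\<close>, so the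
  drop is at most 0, or it strictly exceeds the one at \<open>p\<close>, so the drop is smaller than
  at \<open>p\<close>. Both stay below the natural budget of \<open>p\<close>, which is
  positive.\<close>

lemma natural_budget_segment_less:
  fixes S :: "'n::finite scoring_rule"
  assumes proper: "strictly_proper S" and cont: "continuous_on pos_simplex S"
    and qc: "quasiconcave S"
    and p: "p \<in> pos_simplex" and q: "q \<in> pos_simplex" and "p \<noteq> q" and t: "0 \<le> t" "t < 1"
  shows "natural_budget S q (t *\<^sub>R p + (1 - t) *\<^sub>R q) < natural_budget S q p"
  unfolding natural_budget_less_iff
proof
  fix \<omega>
  define c where "c = (\<lambda>t. t *\<^sub>R p + (1 - t) *\<^sub>R q)"
  have c: "c x \<in> pos_simplex" if "x \<in> {0..1}" for x
    using that segment_in_pos_simplex[OF p q] by (auto simp: c_def)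
  have c_mid: "c ((x + y) / 2) = (1/2) *\<^sub>R c x + (1/2) *\<^sub>R c y" for x y
    by (simp add: c_def vec_eq_iff field_simps)
  have "continuous_on {0..1} (\<lambda>t. S (c t))"
    by (rule continuous_on_compose2[OF cont]) (use c in \<open>auto simp: c_def intro!: continuous_intros\<close>)
  then have contg: "continuous_on {0..1} (\<lambda>t. S (c t) $ \<omega>)" by (intro continuous_intros)
  have "S (c 0) $ \<omega> \<le> S (c t) $ \<omega> \<or> S (c 1) $ \<omega> < S (c t) $ \<omega>"
  proof (rule midpoint_quasiconcave_segment[OF contg _ _ t])
    fix x y :: real assume "x \<in> {0..1}" "y \<in> {0..1}"
    then have "c x \<in> prob_simplex" "c y \<in> prob_simplex" using c pos_simplex_subset by auto
    then show "min (S (c x) $ \<omega>) (S (c y) $ \<omega>) \<le> S (c ((x + y) / 2)) $ \<omega>"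
      and "S (c ((x + y) / 2)) $ \<omega> = min (S (c x) $ \<omega>) (S (c y) $ \<omega>) \<Longrightarrow>
        S (c x) $ \<omega> = S (c y) $ \<omega>"
      using qc unfolding quasiconcave_def c_mid by blast+
  qed
  moreover have "0 < natural_budget S q p"
    using natural_budget_pos[OF proper] p q \<open>p \<noteq> q\<close> pos_simplex_subset by blast
  ultimately show "S q $ \<omega> - S (t *\<^sub>R p + (1 - t) *\<^sub>R q) $ \<omega> < natural_budget S q p"
    using natural_budget_ge[of S q \<omega> p] by (auto simp: c_def)
qed

section \<open>Interior reports as constrained optima\<close>

text \<open>The natural budget increases strictly along the segment, so with exactly the budget of
  \<open>r\<close> the largest affordable weight is \<open>t\<close>.\<close>

lemma segment_point_optimal:
  fixes S :: "'n::finite scoring_rule"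
  assumes S: "budget_truthful S" and cont: "continuous_on pos_simplex S" and qc: "quasiconcave S"
    and p: "p \<in> pos_simplex" and q: "q \<in> pos_simplex" and "p \<noteq> q" and t: "0 < t" "t \<le> 1"
  defines "r \<equiv> t *\<^sub>R p + (1 - t) *\<^sub>R q"
  shows "is_optimal_report S p q (natural_budget S q r) r"
proof -
  have proper: "strictly_proper S" by (rule budget_truthful_imp_strictly_proper[OF S])
  have pS: "p \<in> prob_simplex" and qS: "q \<in> prob_simplex" using p q pos_simplex_subset by auto
  have rq: "s *\<^sub>R p + (1 - s) *\<^sub>R q \<noteq> q" if "0 < s" for s
  proof -
    have "s *\<^sub>R p + (1 - s) *\<^sub>R q - q = s *\<^sub>R (p - q)" by (simp add: algebra_simps)
    then show ?thesis using that \<open>p \<noteq> q\<close> by auto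
  qed
  have "r \<in> prob_simplex" unfolding r_def using t by (intro segment_in_prob_simplex pS qS) auto
  then have pos: "0 < natural_budget S q r"
    using natural_budget_pos[OF proper _ qS] rq t by (auto simp: r_def)
  have aff: "t \<in> affordable_weights S p q (natural_budget S q r)"
    using t by (auto simp: affordable_weights_def r_def)
  have "s \<le> t" if s: "s \<in> affordable_weights S p q (natural_budget S q r)" for s
  proof (rule ccontr)
    assume "\<not> s \<le> t"
    then have st: "t < s" "s \<le> 1" using s by (auto simp: affordable_weights_def)
    \<comment> \<open>The point \<open>r\<close> lies on the segment from \<open>q\<close> to the
      farther point \<open>u\<close>, at weight \<open>t/s\<close>, so \<open>u\<close> costs
      strictly more than \<open>r\<close> and cannot be affordable.\<close>
    define u where "u = s *\<^sub>R p + (1 - s) *\<^sub>R q"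
    have "u \<in> pos_simplex" unfolding u_def using st t by (intro segment_in_pos_simplex p q) auto
    moreover have "u \<noteq> q" unfolding u_def using st t by (intro rq) auto
    ultimately have "natural_budget S q ((t/s) *\<^sub>R u + (1 - t/s) *\<^sub>R q) < natural_budget S q u"
      using st t by (intro natural_budget_segment_less[OF proper cont qc _ q]) auto
    moreover have "(t/s) *\<^sub>R u + (1 - t/s) *\<^sub>R q = r"
      using st t by (simp add: u_def r_def vec_eq_iff field_simps)
    ultimately show False using s by (auto simp: affordable_weights_def u_def)
  qed
  then show ?thesis
    unfolding r_def using optimal_report_affordable_max(1)[OF S pS qS pos aff] by (simp add: r_def)
qed

text \<open>Extending the segment from \<open>q\<close> slightly past \<open>r\<close> gives a
  belief \<open>p\<close> for which \<open>r\<close> is optimal. The extension preserves the order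
  of the ratios: \<open>p\<close> relative to \<open>r\<close> favours \<open>i\<close> over
  \<open>j\<close> just as \<open>r\<close> relative to \<open>q\<close> does, so the constraint of
  \<open>j\<close> binds.\<close>

lemma natural_budget_attained:
  fixes S :: "'n::finite scoring_rule"
  assumes S: "budget_truthful S" and cont: "continuous_on pos_simplex S" and qc: "quasiconcave S"
    and q: "q \<in> pos_simplex" and r: "r \<in> pos_simplex"
    and less: "q $ i * r $ j < r $ i * q $ j"
  shows "S q $ j - S r $ j = natural_budget S q r"
proof -
  have "r \<noteq> q" using less by auto
  have "((\<lambda>\<delta>. r + \<delta> *\<^sub>R (r - q)) \<longlongrightarrow> r) (at_right 0)" by (auto intro!: tendsto_eq_intros)
  moreover have "r \<in> {p. \<forall>\<omega>. 0 < p $ \<omega>}" using r by (auto simp: pos_simplex_def)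
  ultimately have "\<forall>\<^sub>F \<delta> in at_right 0. r + \<delta> *\<^sub>R (r - q) \<in> {p. \<forall>\<omega>. 0 < p $ \<omega>}"
    using open_positive topological_tendstoD by blast
  moreover have "\<forall>\<^sub>F \<delta> in at_right 0. (0::real) < \<delta>" by (rule eventually_at_right_less)
  ultimately obtain \<delta> where \<delta>: "0 < \<delta>" "r + \<delta> *\<^sub>R (r - q) \<in> {p. \<forall>\<omega>. 0 < p $ \<omega>}"
    using eventually_happens'[OF _ eventually_conj] trivial_limit_at_right_real by blast
  define p where "p = r + \<delta> *\<^sub>R (r - q)"
  have p: "p \<in> pos_simplex"
    using \<delta> q r by (auto simp: pos_simplex_def p_def sum.distrib sum_subtractf simp flip: sum_distrib_left)
  have "p - q = (1 + \<delta>) *\<^sub>R (r - q)" by (simp add: p_def algebra_simps)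
  then have "p \<noteq> q" using \<delta> \<open>r \<noteq> q\<close> by auto
  \<comment> \<open>As \<open>p - q\<close> is \<open>1 + \<delta>\<close> times
    \<open>r - q\<close>, this weight on \<open>p\<close> gives back \<open>r\<close>.\<close>
  define t where "t = 1 / (1 + \<delta>)"
  have t: "0 < t" "t \<le> 1" using \<delta> by (auto simp: t_def)
  have "t * (r $ \<omega> + \<delta> * (r $ \<omega> - q $ \<omega>)) + (1 - t) * q $ \<omega> = r $ \<omega>" for \<omega>
    using \<delta> by (simp add: t_def divide_simps) (simp add: algebra_simps)
  then have "t *\<^sub>R p + (1 - t) *\<^sub>R q = r" by (simp add: p_def vec_eq_iff)
  with segment_point_optimal[OF S cont qc p q \<open>p \<noteq> q\<close> t]
  have opt: "is_optimal_report S p q (natural_budget S q r) r" by simp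
  have "p $ i * r $ j - p $ j * r $ i = \<delta> * (r $ i * q $ j - q $ i * r $ j)"
    by (simp add: p_def algebra_simps)
  also have "\<dots> > 0" using less \<delta> by simp
  finally have "p $ j * r $ i < p $ i * r $ j" by simp
  then show ?thesis
    by (rule optimal_report_binding[OF budget_truthful_imp_strictly_proper[OF S] cont p r opt])
qed

section \<open>Two reports with opposite natural budgets\<close>

theorem theorem4:
  assumes "CARD('n::finite) \<ge> 3"
  shows "\<not> (\<exists>S :: 'n scoring_rule. technical_conditions S \<and> budget_truthful S)"
proof
  assume "\<exists>S :: 'n scoring_rule. technical_conditions S \<and> budget_truthful S"
  then obtain S :: "'n scoring_rule" where S: "budget_truthful S" and qc: "quasiconcave S"
    and "differentiable_inside S"
    by (auto simp: technical_conditions_def)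
  then have cont: "continuous_on pos_simplex S"
    using pos_simplex_subset_rel_interior continuous_on_subset
    by (auto simp: differentiable_inside_def)
  have proper: "strictly_proper S" by (rule budget_truthful_imp_strictly_proper[OF S])
  obtain T :: "'n set" where "card T = 3" using obtain_subset_with_card_n[OF assms] by blast
  then obtain a b c :: 'n where abc: "a \<noteq> b" "b \<noteq> c" "a \<noteq> c" by (auto simp: card_3_iff)
  define k where "k = real CARD('n)"
  have k: "0 < k" by (simp add: k_def)
  define v :: "real^'n" where "v = (\<chi> i. 1 / k)"
  \<comment> \<open>Relative to the uniform \<open>v\<close>, the ratio is 3/2 at \<open>a\<close>,
    1/2 at \<open>c\<close> and 1 elsewhere: \<open>a\<close> maximizes it alone, and
    \<open>c\<close> alone maximizes its inverse.\<close>
  define u :: "real^'n" where "u = v + (1 / (2 * k)) *\<^sub>R (axis a 1 - axis c 1)"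
  have u_nth: "u $ i = (if i = a then 3 / (2 * k) else if i = c then 1 / (2 * k) else 1 / k)" for i
    using k abc by (auto simp: u_def v_def axis_def field_simps)
  have v: "v \<in> pos_simplex" using k by (simp add: v_def pos_simplex_def k_def)
  have "(\<Sum>i\<in>UNIV. u $ i) = (\<Sum>i\<in>UNIV. v $ i) +
      1 / (2 * k) * (\<Sum>i\<in>UNIV. (axis a 1 - axis c (1::real)) $ i)"
    by (simp add: u_def sum.distrib flip: sum_divide_distrib)
  also have "\<dots> = 1" using v by (simp add: sum_subtractf axis_def pos_simplex_def)
  finally have "(\<Sum>i\<in>UNIV. u $ i) = 1" .
  then have u: "u \<in> pos_simplex" using k by (simp add: pos_simplex_def u_nth)
  have uv: "S v $ j - S u $ j = natural_budget S v u" if "j \<noteq> a" for j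
    using that k by (intro natural_budget_attained[OF S cont qc v u, of a])
      (auto simp: u_nth v_def field_simps)
  have vu: "S u $ j - S v $ j = natural_budget S u v" if "j \<noteq> c" for j
    using that k abc by (intro natural_budget_attained[OF S cont qc u v, of c])
      (auto simp: u_nth v_def field_simps)
  \<comment> \<open>Outcome \<open>b\<close> is neither \<open>a\<close> nor \<open>c\<close>, so
    its score difference computes both budgets, with opposite signs.\<close>
  have "natural_budget S u v = - natural_budget S v u" using uv[of b] vu[of b] abc by simp
  have "u $ a \<noteq> v $ a" using k by (simp add: u_nth v_def field_simps)
  then have "u \<noteq> v" by auto
  moreover have "u \<in> prob_simplex" "v \<in> prob_simplex" using u v pos_simplex_subset by auto
  ultimately have "0 < natural_budget S v u" "0 < natural_budget S u v"
    using natural_budget_pos[OF proper] by auto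
  then show False using \<open>natural_budget S u v = - natural_budget S v u\<close> by simp
qed

end
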